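(* Let $G$ be a finite group, $H\le G$, and $S\subset G$ such that $S=HSH$ and $S\cap H=\emptyset$. If $K$ with $H\le K\le G$ is chosen to be maximal such that $S=KSK$, $\mathcal{B}$ is the set of left cosets of $K$ in $G$, $\mathcal{C}$ is the set of left cosets of $H$ in $G$, and $k=|K|$, then $$\mathrm{Aut}(\mathrm{Cay}(G,S))\cong(\mathrm{Aut}(\mathrm{Cos}(G,H,S))/(\mathcal{B}/\mathcal{C}))\wr S_k.$$
   Context: For $H\le G$ and $S\subset G$ with $S\cap H=\emptyset$ and $HSH=S$, the double coset digraph $\mathrm{Cos}(G,H,S)$ has as vertices the left cosets of $H$ in $G$ and arc set $\{(gH,gsH):g\in G,s\in S\}$; $H$ is not required to be core-free. For $S\subset G$ with $1\notin S$, the Cayley digraph $\mathrm{Cay}(G,S)$ has vertex set $G$ and arc set $\{(g,gs):g\in G,s\in S\}$. Since $H\le K$, every left coset of $K$ is a union of left cosets of $H$; $\mathcal{B}/\mathcal{C}$ denotes the partition of $\mathcal{C}=V(\mathrm{Cos}(G,H,S))$ whose parts are the sets of left cosets of $H$ contained in a given left coset of $K$. If $A$ is a transitive permutation group with a block system $\mathcal{D}$ (a partition of the permuted set into blocks permuted by $A$), then $A/\mathcal{D}$ denotes the permutation group on the set $\mathcal{D}$ induced by $A$. For permutation groups $P\le S_X$, $Q\le S_Y$, the wreath product $P\wr Q$ is the group of all permutations of $X\times Y$ of the form $(x,y)\mapsto(p(x),q_x(y))$ with $p\in P$ and each $q_x\in Q$. $S_k$ is the symmetric group acting on $k$ points.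 *)

theory Defs
  imports
    "HOL-Algebra.Left_Coset"
    "HOL-Algebra.Sym_Groups"
    "HOL-Library.Disjoint_Sets"
    "Graph_Theory.Pair_Digraph"
begin

section \<open>Double coset digraphs and Cayley digraphs\<close>

definition Cos :: "('a, 'b) monoid_scheme \<Rightarrow> 'a set \<Rightarrow> 'a set \<Rightarrow> 'a set pair_pre_digraph" where
  "Cos G H S =
    \<lparr> pverts = lcosets\<^bsub>G\<^esub> H,
      parcs = {(g <#\<^bsub>G\<^esub> H, (g \<otimes>\<^bsub>G\<^esub> s) <#\<^bsub>G\<^esub> H) | g s. g \<in> carrier G \<and> s \<in> S} \<rparr>"

definition Cay :: "('a, 'b) monoid_scheme \<Rightarrow> 'a set \<Rightarrow> 'a pair_pre_digraph" where
  "Cay G S =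
    \<lparr> pverts = carrier G,
      parcs = {(g, g \<otimes>\<^bsub>G\<^esub> s) | g s. g \<in> carrier G \<and> s \<in> S} \<rparr>"

section \<open>Permutation groups\<close>

text \<open>
  A permutation group on a set \<open>X\<close> consists of functions that permute \<open>X\<close> in the sense of
  \<^const>\<open>permutes\<close> (in particular, they are the identity outside \<open>X\<close>), with composition as
  product. This is the convention of \<^const>\<open>sym_group\<close>.
\<close>

definition perm_monoid :: "('x \<Rightarrow> 'x) set \<Rightarrow> ('x \<Rightarrow> 'x) monoid" where
  "perm_monoid P = \<lparr> carrier = P, monoid.mult = (\<circ>), one = id \<rparr>"

definition Aut :: "'v pair_pre_digraph \<Rightarrow> ('v \<Rightarrow> 'v) monoid" where
  "Aut \<Gamma> = perm_monoid
    {p. p permutes pverts \<Gamma> \<and>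
        (\<forall>u\<in>pverts \<Gamma>. \<forall>v\<in>pverts \<Gamma>. (p u, p v) \<in> parcs \<Gamma> \<longleftrightarrow> (u, v) \<in> parcs \<Gamma>)}"

definition transitive_on :: "'x set \<Rightarrow> ('x \<Rightarrow> 'x) monoid \<Rightarrow> bool" where
  "transitive_on X A \<longleftrightarrow> (\<forall>x\<in>X. \<forall>y\<in>X. \<exists>a\<in>carrier A. a x = y)"

definition block_system :: "'x set \<Rightarrow> ('x \<Rightarrow> 'x) monoid \<Rightarrow> 'x set set \<Rightarrow> bool" where
  "block_system X A D \<longleftrightarrow>
    transitive_on X A \<and> partition_on X D \<and> (\<forall>a\<in>carrier A. \<forall>B\<in>D. a ` B \<in> D)"

text \<open>
  The group \<open>A/D\<close> of permutations of \<open>D\<close> induced by \<open>A\<close>; it is meaningful when \<open>D\<close> is a block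
  system of \<open>A\<close>.
\<close>

definition block_quotient :: "('x \<Rightarrow> 'x) monoid \<Rightarrow> 'x set set \<Rightarrow> ('x set \<Rightarrow> 'x set) monoid" where
  "block_quotient A D =
    perm_monoid {(\<lambda>B. if B \<in> D then a ` B else B) | a. a \<in> carrier A}"

text \<open>The wreath product of \<open>P\<close>, acting on \<open>X\<close>, with \<open>Q\<close>, acting on \<open>Y\<close>.\<close>

definition wreath ::
  "'x set \<Rightarrow> ('x \<Rightarrow> 'x) monoid \<Rightarrow> 'y set \<Rightarrow> ('y \<Rightarrow> 'y) monoid \<Rightarrow> ('x \<times> 'y \<Rightarrow> 'x \<times> 'y) monoid" where
  "wreath X P Y Q = perm_monoid
    {w. w permutes (X \<times> Y) \<and>
        (\<exists>p\<in>carrier P. \<exists>q. (\<forall>x\<in>X. q x \<in> carrier Q) \<and>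
          (\<forall>x\<in>X. \<forall>y\<in>Y. w (x, y) = (p x, q x y)))}"

section \<open>Partitions of cosets\<close>

definition coset_partition :: "'a set set \<Rightarrow> 'a set set \<Rightarrow> 'a set set set" where
  "coset_partition \<B> \<C> = {{C \<in> \<C>. C \<subseteq> B} | B. B \<in> \<B>}"

end

theory Submission
  imports Defs
begin

text \<open>
  Call two vertices of a digraph twins if they have the same in-neighbours and the same
  out-neighbours. In \<open>Cay(G, S)\<close> there is an arc from \<open>x\<close> to \<open>y\<close> iff \<open>x\<^sup>-\<^sup>1 y \<in> S\<close>, so \<open>x\<close> and \<open>y\<close> are
  twins iff \<open>x\<^sup>-\<^sup>1 y\<close> lies in the two-sided stabilizer \<open>{g. g S = S = S g}\<close>. A subgroup \<open>L\<close> satisfies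
  \<open>S = L S L\<close> iff it is contained in this stabilizer, which is itself a subgroup; hence the
  maximal such \<open>K\<close> is the whole stabilizer (\<open>maximal_eq_two_sided_stabilizer\<close>), and the twin classes of
  \<open>Cay(G, S)\<close> are exactly the left cosets of \<open>K\<close>. Since \<open>H \<le> K\<close>, the same description of arcs is
  valid for \<open>Cos(G, H, S)\<close>, whose twin classes are therefore the parts of \<open>\<B>/\<C>\<close>.

  Collapsing the twin classes of either digraph gives one and the same twin-free digraph \<open>\<Delta>\<close> on
  \<open>\<B>/\<C>\<close>. Both are thus blow-ups of \<open>\<Delta>\<close> (locale \<open>blow_up\<close>): each vertex of \<open>\<Delta>\<close> is replaced by a fibre of
  vertices without changing adjacency. For a blow-up \<open>\<Gamma>\<close> of a twin-free \<open>\<Delta>\<close>, automorphisms preserve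
  the twin relation, so they permute the fibres and induce automorphisms of \<open>\<Delta>\<close> (\<open>Aut_induces\<close>);
  conversely every permutation of the vertices that lies over an automorphism of \<open>\<Delta>\<close> is an
  automorphism of \<open>\<Gamma>\<close> (\<open>Aut_if_induces\<close>), and if the fibres have equal size then every automorphism of
  \<open>\<Delta>\<close> has a lift (\<open>Aut_lift\<close>).

  Three blow-ups of \<open>\<Delta>\<close> give the result. For \<open>Cos(G, H, S)\<close>, whose fibres have equal size because left
  translations act transitively, it says that the fibres form a block system and that the group
  induced on the fibres is \<open>Aut(\<Delta>)\<close>. For the digraph on \<open>V(\<Delta>) \<times> {1..k}\<close> with adjacency read off from the
  first coordinate, it says that the automorphism group is the wreath product of \<open>Aut(\<Delta>)\<close> with \<open>S\<^sub>k\<close>.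
  Finally \<open>Cay(G, S)\<close> has fibres of size \<open>k = |K|\<close>, so it is isomorphic to that product digraph.
\<close>

section \<open>Automorphism groups of digraphs\<close>

lemma Aut_memI:
  assumes "p permutes pverts \<Gamma>"
    and "\<And>u v. \<lbrakk>u \<in> pverts \<Gamma>; v \<in> pverts \<Gamma>\<rbrakk> \<Longrightarrow> (p u, p v) \<in> parcs \<Gamma> \<longleftrightarrow> (u, v) \<in> parcs \<Gamma>"
  shows "p \<in> carrier (Aut \<Gamma>)"
  using assms by (simp add: Aut_def perm_monoid_def)

lemma Aut_permutes: "p \<in> carrier (Aut \<Gamma>) \<Longrightarrow> p permutes pverts \<Gamma>"
  by (simp add: Aut_def perm_monoid_def)

lemma Aut_arcs:
  "\<lbrakk>p \<in> carrier (Aut \<Gamma>); u \<in> pverts \<Gamma>; v \<in> pverts \<Gamma>\<rbrakk> \<Longrightarrow> (p u, p v) \<in> parcs \<Gamma> \<longleftrightarrow> (u, v) \<in> parcs \<Gamma>"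
  by (simp add: Aut_def perm_monoid_def)

lemma Aut_in_verts:
  "p \<in> carrier (Aut \<Gamma>) \<Longrightarrow> v \<in> pverts \<Gamma> \<Longrightarrow> p v \<in> pverts \<Gamma>"
  by (simp add: Aut_permutes permutes_in_image)

lemma Aut_eq_perm_monoid: "Aut \<Gamma> = perm_monoid (carrier (Aut \<Gamma>))"
  by (simp add: Aut_def perm_monoid_def)

text \<open>
  The isomorphism is conjugation by \<open>f\<close>. Automorphisms are the identity outside the vertex set, so
  the conjugate has to be extended by the identity.
\<close>

lemma Aut_iso_if_digraph_iso:
  assumes bij: "bij_betw f (pverts \<Gamma>) (pverts \<Gamma>')"
    and arcs: "\<And>u v. \<lbrakk>u \<in> pverts \<Gamma>; v \<in> pverts \<Gamma>\<rbrakk> \<Longrightarrow> (f u, f v) \<in> parcs \<Gamma>' \<longleftrightarrow> (u, v) \<in> parcs \<Gamma>"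
  shows "Aut \<Gamma> \<cong> Aut \<Gamma>'"
proof -
  let ?V = "pverts \<Gamma>" and ?V' = "pverts \<Gamma>'"
  let ?g = "inv_into ?V f"
  define F where "F a y = (if y \<in> ?V' then f (a (?g y)) else y)" for a y
  define F' where "F' b x = (if x \<in> ?V then ?g (b (f x)) else x)" for b x
  have bij': "bij_betw ?g ?V' ?V" using bij by (rule bij_betw_inv_into)
  have gf: "?g (f x) = x" if "x \<in> ?V" for x
    using bij that by (simp add: bij_betw_inv_into_left)
  have fg: "f (?g y) = y" if "y \<in> ?V'" for y
    using bij that by (simp add: bij_betw_inv_into_right)
  have f_in: "f x \<in> ?V'" if "x \<in> ?V" for x using bij that by (rule bij_betwE[rule_format])
  have g_in: "?g y \<in> ?V" if "y \<in> ?V'" for y using bij' that by (rule bij_betwE[rule_format])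
  have inv_g: "inv_into ?V' ?g x = f x" if "x \<in> ?V" for x
    using bij that by (metis bij' bij_betw_inv_into_left f_in gf)
  have F_in: "F a \<in> carrier (Aut \<Gamma>')" if a: "a \<in> carrier (Aut \<Gamma>)" for a
  proof (rule Aut_memI)
    show "F a permutes ?V'"
      unfolding F_def using permutes_bij_inv_into[OF Aut_permutes[OF a] bij] .
    fix u v assume "u \<in> ?V'" "v \<in> ?V'"
    then show "(F a u, F a v) \<in> parcs \<Gamma>' \<longleftrightarrow> (u, v) \<in> parcs \<Gamma>'"
      using arcs[of "a (?g u)" "a (?g v)"] arcs[of "?g u" "?g v"] Aut_arcs[OF a, of "?g u" "?g v"]
      by (simp add: F_def fg g_in Aut_in_verts[OF a])
  qed
  have F'_in: "F' b \<in> carrier (Aut \<Gamma>)" if b: "b \<in> carrier (Aut \<Gamma>')" for b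
  proof (rule Aut_memI)
    have "(\<lambda>x. if x \<in> ?V then ?g (b (inv_into ?V' ?g x)) else x) permutes ?V"
      using permutes_bij_inv_into[OF Aut_permutes[OF b] bij'] .
    moreover have "F' b = (\<lambda>x. if x \<in> ?V then ?g (b (inv_into ?V' ?g x)) else x)"
      by (rule ext) (simp add: F'_def inv_g)
    ultimately show "F' b permutes ?V" by simp
    fix u v assume "u \<in> ?V" "v \<in> ?V"
    then show "(F' b u, F' b v) \<in> parcs \<Gamma> \<longleftrightarrow> (u, v) \<in> parcs \<Gamma>"
      using arcs[of "?g (b (f u))" "?g (b (f v))"] arcs[of u v] Aut_arcs[OF b, of "f u" "f v"]
      by (simp add: F'_def fg g_in f_in Aut_in_verts[OF b])
  qed
  have "F' (F a) = a" if a: "a \<in> carrier (Aut \<Gamma>)" for a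
    using Aut_in_verts[OF a] permutes_not_in[OF Aut_permutes[OF a]]
    by (auto simp: F_def F'_def gf f_in)
  moreover have "F (F' b) = b" if b: "b \<in> carrier (Aut \<Gamma>')" for b
    using Aut_in_verts[OF b] permutes_not_in[OF Aut_permutes[OF b]]
    by (auto simp: F_def F'_def fg g_in)
  ultimately have "bij_betw F (carrier (Aut \<Gamma>)) (carrier (Aut \<Gamma>'))"
    using F_in F'_in by (intro bij_betw_byWitness[where f' = F']) auto
  moreover have "F (a \<circ> b) = F a \<circ> F b" if "b \<in> carrier (Aut \<Gamma>)" for a b
    using Aut_in_verts[OF that] by (auto simp: F_def gf f_in g_in)
  then have "F \<in> hom (Aut \<Gamma>) (Aut \<Gamma>')"
    using F_in by (auto simp: hom_def Aut_def perm_monoid_def)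
  ultimately show ?thesis by (auto simp: is_iso_def iso_def)
qed

section \<open>Blow-ups of twin-free digraphs\<close>

text \<open>
  Each vertex \<open>x\<close> of \<open>\<Delta>\<close> is replaced by its fibre under \<open>\<pi>\<close>. As no two vertices of \<open>\<Delta>\<close> have the same
  neighbourhoods, the fibres can be recovered from \<open>\<Gamma>\<close> alone; this is what forces every automorphism
  of \<open>\<Gamma>\<close> to respect them.
\<close>

locale blow_up =
  fixes \<Gamma> :: "'v pair_pre_digraph" and \<Delta> :: "'x pair_pre_digraph" and \<pi> :: "'v \<Rightarrow> 'x"
  assumes verts: "\<pi> ` pverts \<Gamma> = pverts \<Delta>"
    and arcs: "\<lbrakk>u \<in> pverts \<Gamma>; v \<in> pverts \<Gamma>\<rbrakk> \<Longrightarrow> (\<pi> u, \<pi> v) \<in> parcs \<Delta> \<longleftrightarrow> (u, v) \<in> parcs \<Gamma>"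
    and twin_free:
      "\<lbrakk>x \<in> pverts \<Delta>; y \<in> pverts \<Delta>;
        \<And>z. z \<in> pverts \<Delta> \<Longrightarrow> (x, z) \<in> parcs \<Delta> \<longleftrightarrow> (y, z) \<in> parcs \<Delta>;
        \<And>z. z \<in> pverts \<Delta> \<Longrightarrow> (z, x) \<in> parcs \<Delta> \<longleftrightarrow> (z, y) \<in> parcs \<Delta>\<rbrakk> \<Longrightarrow> x = y"
begin

lemma proj_in: "v \<in> pverts \<Gamma> \<Longrightarrow> \<pi> v \<in> pverts \<Delta>"
  using verts by blast

lemma proj_onto:
  assumes "x \<in> pverts \<Delta>" obtains v where "v \<in> pverts \<Gamma>" "x = \<pi> v"
  using assms verts by blast

lemma same_fibre_iff_twins:
  assumes "u \<in> pverts \<Gamma>" "v \<in> pverts \<Gamma>"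
  shows "\<pi> u = \<pi> v \<longleftrightarrow> (\<forall>w\<in>pverts \<Gamma>. ((u, w) \<in> parcs \<Gamma> \<longleftrightarrow> (v, w) \<in> parcs \<Gamma>) \<and>
    ((w, u) \<in> parcs \<Gamma> \<longleftrightarrow> (w, v) \<in> parcs \<Gamma>))" (is "_ \<longleftrightarrow> ?twins")
proof
  assume "\<pi> u = \<pi> v"
  then show ?twins using assms by (metis arcs)
next
  assume ?twins
  then show "\<pi> u = \<pi> v"
    using assms by (intro twin_free) (auto simp: arcs proj_in elim!: proj_onto)
qed

text \<open>
  Lying in the same fibre means being twins, which is a property that automorphisms preserve.
\<close>

lemma Aut_respects_fibres:
  assumes a: "a \<in> carrier (Aut \<Gamma>)" and uv: "u \<in> pverts \<Gamma>" "v \<in> pverts \<Gamma>"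
  shows "\<pi> (a u) = \<pi> (a v) \<longleftrightarrow> \<pi> u = \<pi> v"
proof -
  have onto: "a ` pverts \<Gamma> = pverts \<Gamma>" using Aut_permutes[OF a] by (rule permutes_image)
  have "\<pi> (a u) = \<pi> (a v) \<longleftrightarrow> (\<forall>w\<in>a ` pverts \<Gamma>. ((a u, w) \<in> parcs \<Gamma> \<longleftrightarrow> (a v, w) \<in> parcs \<Gamma>) \<and>
    ((w, a u) \<in> parcs \<Gamma> \<longleftrightarrow> (w, a v) \<in> parcs \<Gamma>))"
    unfolding onto using uv by (intro same_fibre_iff_twins) (simp_all add: Aut_in_verts[OF a])
  also have "\<dots> \<longleftrightarrow> \<pi> u = \<pi> v"
    using uv by (simp add: same_fibre_iff_twins Aut_arcs[OF a])
  finally show ?thesis .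
qed

text \<open>
  The induced map sends a vertex of \<open>\<Delta>\<close> to the projection of the image of any vertex in its fibre.
  It is well defined and injective because automorphisms respect fibres in both directions.
\<close>

lemma Aut_induces:
  assumes a: "a \<in> carrier (Aut \<Gamma>)"
  obtains p where "p \<in> carrier (Aut \<Delta>)" "\<And>v. v \<in> pverts \<Gamma> \<Longrightarrow> \<pi> (a v) = p (\<pi> v)"
proof -
  define s where "s = inv_into (pverts \<Gamma>) \<pi>"
  define p where "p x = (if x \<in> pverts \<Delta> then \<pi> (a (s x)) else x)" for x
  have s: "s x \<in> pverts \<Gamma>" "\<pi> (s x) = x" if "x \<in> pverts \<Delta>" for x
    using that verts by (auto simp: s_def inv_into_into f_inv_into_f)
  have p: "\<pi> (a v) = p (\<pi> v)" if "v \<in> pverts \<Gamma>" for v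
    using that Aut_respects_fibres[OF a that, of "s (\<pi> v)"] by (simp add: p_def proj_in s)
  have p_in: "p x \<in> pverts \<Delta>" if "x \<in> pverts \<Delta>" for x
    using that by (simp add: p_def proj_in Aut_in_verts[OF a] s)
  have "inj_on p (pverts \<Delta>)"
  proof (rule inj_onI)
    fix x y assume "x \<in> pverts \<Delta>" "y \<in> pverts \<Delta>" "p x = p y"
    then show "x = y" using Aut_respects_fibres[OF a, of "s x" "s y"] s by (simp add: p_def)
  qed
  moreover have "p ` pverts \<Delta> = pverts \<Delta>"
  proof -
    have "p ` pverts \<Delta> = (\<lambda>v. \<pi> (a v)) ` pverts \<Gamma>"
      unfolding verts[symmetric] image_image using p by (intro image_cong) auto
    also have "\<dots> = \<pi> ` a ` pverts \<Gamma>" by (simp add: image_image)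
    finally show ?thesis by (simp add: permutes_image[OF Aut_permutes[OF a]] verts)
  qed
  ultimately have "p permutes pverts \<Delta>"
    by (intro bij_imp_permutes) (auto simp: bij_betw_def p_def)
  then have "p \<in> carrier (Aut \<Delta>)"
  proof (rule Aut_memI)
    fix x y assume "x \<in> pverts \<Delta>" "y \<in> pverts \<Delta>"
    then show "(p x, p y) \<in> parcs \<Delta> \<longleftrightarrow> (x, y) \<in> parcs \<Delta>"
      using arcs[of "a (s x)" "a (s y)"] arcs[of "s x" "s y"] Aut_arcs[OF a, of "s x" "s y"]
      by (simp add: p_def s Aut_in_verts[OF a])
  qed
  then show ?thesis using p that by blast
qed

lemma Aut_if_induces:
  assumes a: "a permutes pverts \<Gamma>" and p: "p \<in> carrier (Aut \<Delta>)"
    and ap: "\<And>v. v \<in> pverts \<Gamma> \<Longrightarrow> \<pi> (a v) = p (\<pi> v)"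
  shows "a \<in> carrier (Aut \<Gamma>)"
  using a
proof (rule Aut_memI)
  fix u v assume "u \<in> pverts \<Gamma>" "v \<in> pverts \<Gamma>"
  then show "(a u, a v) \<in> parcs \<Gamma> \<longleftrightarrow> (u, v) \<in> parcs \<Gamma>"
    using arcs[of "a u" "a v"] arcs[of u v] Aut_arcs[OF p, of "\<pi> u" "\<pi> v"] a
    by (simp add: ap proj_in permutes_in_image)
qed

text \<open>
  A bijection with \<open>V(\<Delta>) \<times> Y\<close> over \<open>V(\<Delta>)\<close> transports the map that applies \<open>p\<close> to the first coordinate
  and leaves the second one alone.
\<close>

lemma Aut_lift:
  assumes bij: "bij_betw \<phi> (pverts \<Gamma>) (pverts \<Delta> \<times> Y)"
    and fst: "\<And>v. v \<in> pverts \<Gamma> \<Longrightarrow> fst (\<phi> v) = \<pi> v"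
    and p: "p \<in> carrier (Aut \<Delta>)"
  obtains a where "a \<in> carrier (Aut \<Gamma>)" "\<And>v. v \<in> pverts \<Gamma> \<Longrightarrow> \<pi> (a v) = p (\<pi> v)"
proof -
  let ?\<psi> = "inv_into (pverts \<Gamma>) \<phi>"
  define a where "a v = (if v \<in> pverts \<Gamma> then ?\<psi> (map_prod p id (\<phi> v)) else v)" for v
  have "bij_betw p (pverts \<Delta>) (pverts \<Delta>)"
    using p by (intro permutes_imp_bij Aut_permutes)
  then have "bij_betw (map_prod p id) (pverts \<Delta> \<times> Y) (pverts \<Delta> \<times> Y)"
    by (intro bij_betw_map_prod) auto
  then have "bij_betw (?\<psi> \<circ> (map_prod p id \<circ> \<phi>)) (pverts \<Gamma>) (pverts \<Gamma>)"
    using bij bij_betw_inv_into[OF bij] by (blast intro: bij_betw_trans)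
  then have "bij_betw a (pverts \<Gamma>) (pverts \<Gamma>)"
    by (rule bij_betw_cong[THEN iffD1, rotated]) (simp add: a_def)
  then have perm: "a permutes pverts \<Gamma>"
    by (rule bij_imp_permutes) (simp add: a_def)
  have "\<pi> (a v) = p (\<pi> v)" if v: "v \<in> pverts \<Gamma>" for v
  proof -
    have "\<phi> v \<in> pverts \<Delta> \<times> Y" using bij v by (auto simp: bij_betw_def)
    then have "map_prod p id (\<phi> v) \<in> pverts \<Delta> \<times> Y"
      using Aut_in_verts[OF p] by auto
    then have "\<phi> (a v) = map_prod p id (\<phi> v)"
      using v bij by (simp add: a_def bij_betw_inv_into_right)
    then have "fst (\<phi> (a v)) = p (fst (\<phi> v))" by simp
    then show ?thesis using v perm by (simp add: fst permutes_in_image)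
  qed
  then show ?thesis using that Aut_if_induces[OF perm p] by blast
qed

text \<open>
  Numbering each fibre separately identifies the vertex set with a product over \<open>V(\<Delta>)\<close>.
\<close>

lemma trivialization:
  assumes fin: "finite (pverts \<Gamma>)"
    and card: "\<And>x. x \<in> pverts \<Delta> \<Longrightarrow> card {v \<in> pverts \<Gamma>. \<pi> v = x} = n"
  obtains \<phi> where "bij_betw \<phi> (pverts \<Gamma>) (pverts \<Delta> \<times> {1..n})"
    "\<And>v. v \<in> pverts \<Gamma> \<Longrightarrow> fst (\<phi> v) = \<pi> v"
proof -
  let ?F = "\<lambda>x. {v \<in> pverts \<Gamma>. \<pi> v = x}"
  have "\<forall>x\<in>pverts \<Delta>. \<exists>h. bij_betw h (?F x) {1..n}"
    using fin card by (intro ballI finite_same_card_bij) auto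
  then obtain h where h: "\<And>x. x \<in> pverts \<Delta> \<Longrightarrow> bij_betw (h x) (?F x) {1..n}" by metis
  define \<phi> where "\<phi> v = (\<pi> v, h (\<pi> v) v)" for v
  have "inj_on \<phi> (pverts \<Gamma>)"
  proof (rule inj_onI)
    fix u v assume "u \<in> pverts \<Gamma>" "v \<in> pverts \<Gamma>" "\<phi> u = \<phi> v"
    then show "u = v"
      using bij_betw_imp_inj_on[OF h[OF proj_in[of u]]] by (auto simp: \<phi>_def dest: inj_onD)
  qed
  moreover have "\<phi> ` pverts \<Gamma> = pverts \<Delta> \<times> {1..n}"
  proof
    show "\<phi> ` pverts \<Gamma> \<subseteq> pverts \<Delta> \<times> {1..n}"
      using h proj_in by (auto simp: \<phi>_def bij_betw_def)
    show "pverts \<Delta> \<times> {1..n} \<subseteq> \<phi> ` pverts \<Gamma>"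
    proof clarify
      fix x y assume "x \<in> pverts \<Delta>" "y \<in> {1..n}"
      then have "y \<in> h x ` ?F x" using bij_betw_imp_surj_on[OF h] by blast
      then obtain v where "v \<in> ?F x" "y = h x v" by blast
      then show "(x, y) \<in> \<phi> ` pverts \<Gamma>" by (auto simp: \<phi>_def)
    qed
  qed
  ultimately show ?thesis using that[of \<phi>] by (auto simp: bij_betw_def \<phi>_def)
qed

lemma card_fibre_le:
  assumes fin: "finite (pverts \<Gamma>)" and a: "a \<in> carrier (Aut \<Gamma>)" and u: "u \<in> pverts \<Gamma>"
  shows "card {v \<in> pverts \<Gamma>. \<pi> v = \<pi> u} \<le> card {v \<in> pverts \<Gamma>. \<pi> v = \<pi> (a u)}"
proof (rule card_inj_on_le[of a])
  show "inj_on a {v \<in> pverts \<Gamma>. \<pi> v = \<pi> u}"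
    using Aut_permutes[OF a] by (simp add: permutes_inj_on)
qed (use fin u in \<open>auto simp: Aut_in_verts[OF a] Aut_respects_fibres[OF a]\<close>)

text \<open>
  Automorphisms between two fibres, one in each direction, show that neither is larger than the other.
\<close>

lemma card_fibre_const:
  assumes fin: "finite (pverts \<Gamma>)" and trans: "transitive_on (pverts \<Gamma>) (Aut \<Gamma>)"
    and u: "u \<in> pverts \<Gamma>" and x: "x \<in> pverts \<Delta>"
  shows "card {v \<in> pverts \<Gamma>. \<pi> v = x} = card {v \<in> pverts \<Gamma>. \<pi> v = \<pi> u}"
proof -
  obtain w where w: "w \<in> pverts \<Gamma>" "x = \<pi> w" using x by (rule proj_onto)
  obtain a b where "a \<in> carrier (Aut \<Gamma>)" "a w = u" "b \<in> carrier (Aut \<Gamma>)" "b u = w"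
    using trans u w(1) unfolding transitive_on_def by blast
  then show ?thesis
    using card_fibre_le[OF fin _ w(1), of a] card_fibre_le[OF fin _ u, of b] w(2) by simp
qed

end

section \<open>The group induced on the fibres\<close>

text \<open>
  Here the vertices of \<open>\<Delta>\<close> are literally the fibres of \<open>\<pi>\<close>, so that the action of \<open>Aut(\<Gamma>)\<close> on the sets
  of vertices of \<open>\<Gamma>\<close> can be compared with the action of \<open>Aut(\<Delta>)\<close> on the vertices of \<open>\<Delta>\<close>.
\<close>

locale block_blow_up = blow_up \<Gamma> \<Delta> \<pi>
  for \<Gamma> :: "'v pair_pre_digraph" and \<Delta> :: "'v set pair_pre_digraph" and \<pi> +
  assumes mem_block_iff: "D \<in> pverts \<Delta> \<Longrightarrow> v \<in> D \<longleftrightarrow> v \<in> pverts \<Gamma> \<and> \<pi> v = D"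
begin

lemma Aut_image_block:
  assumes a: "a \<in> carrier (Aut \<Gamma>)" and p: "p \<in> carrier (Aut \<Delta>)"
    and ap: "\<And>v. v \<in> pverts \<Gamma> \<Longrightarrow> \<pi> (a v) = p (\<pi> v)" and D: "D \<in> pverts \<Delta>"
  shows "a ` D = p D"
proof
  have pD: "p D \<in> pverts \<Delta>" using p D by (rule Aut_in_verts)
  show "a ` D \<subseteq> p D"
    by (auto simp: mem_block_iff[OF D] mem_block_iff[OF pD] ap Aut_in_verts[OF a])
  show "p D \<subseteq> a ` D"
  proof
    fix w assume "w \<in> p D"
    then have w: "w \<in> pverts \<Gamma>" "\<pi> w = p D" by (simp_all add: mem_block_iff[OF pD])
    then obtain v where v: "v \<in> pverts \<Gamma>" "w = a v"
      using permutes_image[OF Aut_permutes[OF a]] by blast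
    then have "p (\<pi> v) = p D" using w by (simp add: ap)
    then have "\<pi> v = D" using permutes_inj[OF Aut_permutes[OF p]] by (simp add: inj_eq)
    then show "w \<in> a ` D" using v by (simp add: mem_block_iff[OF D])
  qed
qed

lemma block_system_blow_up:
  assumes trans: "transitive_on (pverts \<Gamma>) (Aut \<Gamma>)"
  shows "block_system (pverts \<Gamma>) (Aut \<Gamma>) (pverts \<Delta>)"
  unfolding block_system_def
proof (intro conjI ballI)
  show "partition_on (pverts \<Gamma>) (pverts \<Delta>)"
  proof (rule partition_onI)
    show "\<Union> (pverts \<Delta>) = pverts \<Gamma>"
      using mem_block_iff proj_in by blast
    show "disjnt p q" if "p \<in> pverts \<Delta>" "q \<in> pverts \<Delta>" "p \<noteq> q" for p q
      using mem_block_iff[OF that(1)] mem_block_iff[OF that(2)] that(3) unfolding disjnt_def by blast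
    have "p \<noteq> {}" if "p \<in> pverts \<Delta>" for p
    proof -
      obtain v where "v \<in> pverts \<Gamma>" "p = \<pi> v" using \<open>p \<in> pverts \<Delta>\<close> by (rule proj_onto)
      then have "v \<in> p" using mem_block_iff[OF that] by simp
      then show ?thesis by blast
    qed
    then show "{} \<notin> pverts \<Delta>" by blast
  qed
  fix a D assume a: "a \<in> carrier (Aut \<Gamma>)" and D: "D \<in> pverts \<Delta>"
  obtain p where p: "p \<in> carrier (Aut \<Delta>)" and ap: "\<And>v. v \<in> pverts \<Gamma> \<Longrightarrow> \<pi> (a v) = p (\<pi> v)"
    using Aut_induces[OF a] by blast
  show "a ` D \<in> pverts \<Delta>"
    using Aut_image_block[OF a p ap D] Aut_in_verts[OF p D] by simp
qed (rule trans)

text \<open>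
  One inclusion is that automorphisms of \<open>\<Gamma>\<close> induce automorphisms of \<open>\<Delta>\<close>. The other one needs
  lifts, and hence the trivialization \<open>\<phi>\<close>.
\<close>

lemma block_quotient_blow_up:
  assumes "bij_betw \<phi> (pverts \<Gamma>) (pverts \<Delta> \<times> Y)"
    and "\<And>v. v \<in> pverts \<Gamma> \<Longrightarrow> fst (\<phi> v) = \<pi> v"
  shows "block_quotient (Aut \<Gamma>) (pverts \<Delta>) = Aut \<Delta>"
proof -
  define Q where "Q a B = (if B \<in> pverts \<Delta> then a ` B else B)" for a :: "'v \<Rightarrow> 'v" and B
  have q: "Q a = p" if "a \<in> carrier (Aut \<Gamma>)" "p \<in> carrier (Aut \<Delta>)"
    "\<And>v. v \<in> pverts \<Gamma> \<Longrightarrow> \<pi> (a v) = p (\<pi> v)" for a p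
  proof
    fix B show "Q a B = p B"
      using Aut_image_block[OF that, of B] permutes_not_in[OF Aut_permutes[OF that(2)], of B] by (simp add: Q_def)
  qed
  have "Q ` carrier (Aut \<Gamma>) = carrier (Aut \<Delta>)"
  proof
    show "Q ` carrier (Aut \<Gamma>) \<subseteq> carrier (Aut \<Delta>)"
    proof (rule image_subsetI)
      fix a assume a: "a \<in> carrier (Aut \<Gamma>)"
      obtain p where p: "p \<in> carrier (Aut \<Delta>)" "\<And>v. v \<in> pverts \<Gamma> \<Longrightarrow> \<pi> (a v) = p (\<pi> v)"
        using Aut_induces[OF a] by blast
      have "Q a = p" using q a p by blast
      then show "Q a \<in> carrier (Aut \<Delta>)" using p(1) by simp
    qed
    show "carrier (Aut \<Delta>) \<subseteq> Q ` carrier (Aut \<Gamma>)"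
    proof
      fix p assume p: "p \<in> carrier (Aut \<Delta>)"
      obtain a where a: "a \<in> carrier (Aut \<Gamma>)" "\<And>v. v \<in> pverts \<Gamma> \<Longrightarrow> \<pi> (a v) = p (\<pi> v)"
        using Aut_lift[OF assms p] by blast
      show "p \<in> Q ` carrier (Aut \<Gamma>)" using q[OF a(1) p a(2), symmetric] a(1) by (rule image_eqI)
    qed
  qed
  then have "block_quotient (Aut \<Gamma>) (pverts \<Delta>) = perm_monoid (carrier (Aut \<Delta>))"
    by (simp add: block_quotient_def setcompr_eq_image Q_def[abs_def])
  then show ?thesis unfolding Aut_eq_perm_monoid[symmetric] .
qed

end

section \<open>The wreath product as an automorphism group\<close>

text \<open>
  The lexicographic product of \<open>\<Delta>\<close> with the arcless digraph on \<open>Y\<close>, which is the model of all blow-ups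
  of \<open>\<Delta>\<close> whose fibres have the size of \<open>Y\<close>.
\<close>

definition lex_empty :: "'x pair_pre_digraph \<Rightarrow> 'y set \<Rightarrow> ('x \<times> 'y) pair_pre_digraph" where
  "lex_empty \<Delta> Y =
    \<lparr> pverts = pverts \<Delta> \<times> Y,
      parcs = {(u, v). u \<in> pverts \<Delta> \<times> Y \<and> v \<in> pverts \<Delta> \<times> Y \<and> (fst u, fst v) \<in> parcs \<Delta>} \<rparr>"

lemma (in blow_up) blow_up_lex_empty:
  assumes "Y \<noteq> {}"
  shows "blow_up (lex_empty \<Delta> Y) \<Delta> fst"
  using assms twin_free by unfold_locales (auto simp: lex_empty_def)

text \<open>
  An element of the wreath product is a permutation of \<open>V(\<Delta>) \<times> {1..n}\<close> lying over an automorphism of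
  \<open>\<Delta>\<close>: on each fibre, such a permutation acts on the second coordinate by an injective map of the
  finite set \<open>{1..n}\<close> into itself, hence by an element of \<open>S\<^sub>n\<close>. The condition \<open>n > 0\<close> makes the
  projection to \<open>V(\<Delta>)\<close> surjective.
\<close>

lemma (in blow_up) wreath_eq_Aut_lex_empty:
  assumes "n > 0"
  shows "wreath (pverts \<Delta>) (Aut \<Delta>) {1..n} (sym_group n) = Aut (lex_empty \<Delta> {1..n})"
proof -
  let ?X = "pverts \<Delta>" and ?Y = "{1..n}"
  interpret lex: blow_up "lex_empty \<Delta> ?Y" \<Delta> fst
    using assms by (intro blow_up_lex_empty) auto
  have V: "pverts (lex_empty \<Delta> ?Y) = ?X \<times> ?Y" by (simp add: lex_empty_def)
  define W where "W = {w. w permutes (?X \<times> ?Y) \<and>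
        (\<exists>p\<in>carrier (Aut \<Delta>). \<exists>q. (\<forall>x\<in>?X. q x \<in> carrier (sym_group n)) \<and>
          (\<forall>x\<in>?X. \<forall>y\<in>?Y. w (x, y) = (p x, q x y)))}"
  have "W = carrier (Aut (lex_empty \<Delta> ?Y))"
  proof (intro equalityI subsetI)
    fix w assume "w \<in> W"
    then obtain p q where perm: "w permutes pverts (lex_empty \<Delta> ?Y)" and p: "p \<in> carrier (Aut \<Delta>)"
      and w: "\<forall>x\<in>?X. \<forall>y\<in>?Y. w (x, y) = (p x, q x y)"
      unfolding W_def V by blast
    have "fst (w v) = p (fst v)" if "v \<in> pverts (lex_empty \<Delta> ?Y)" for v
      using that w unfolding V by (metis fst_conv mem_Times_iff prod.collapse)
    then show "w \<in> carrier (Aut (lex_empty \<Delta> ?Y))" by (rule lex.Aut_if_induces[OF perm p])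
  next
    fix w assume w: "w \<in> carrier (Aut (lex_empty \<Delta> ?Y))"
    have perm: "w permutes (?X \<times> ?Y)" using Aut_permutes[OF w] unfolding V .
    obtain p where p: "p \<in> carrier (Aut \<Delta>)" and wp: "\<And>v. v \<in> ?X \<times> ?Y \<Longrightarrow> fst (w v) = p (fst v)"
      using lex.Aut_induces[OF w] unfolding V by blast
    define q where "q x y = (if y \<in> ?Y then snd (w (x, y)) else y)" for x y
    have wq: "w (x, y) = (p x, q x y)" if "x \<in> ?X" "y \<in> ?Y" for x y
      using wp[of "(x, y)"] that by (simp add: q_def prod_eq_iff)
    have "q x permutes ?Y" if x: "x \<in> ?X" for x
    proof (rule bij_imp_permutes)
      have "inj_on (q x) ?Y"
      proof (rule inj_onI)
        fix y z assume "y \<in> ?Y" "z \<in> ?Y" "q x y = q x z"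
        then have "w (x, y) = w (x, z)" using wq x by simp
        then show "y = z" using permutes_inj[OF perm] by (simp add: inj_eq)
      qed
      moreover have "q x ` ?Y \<subseteq> ?Y"
      proof clarify
        fix y assume y: "y \<in> ?Y"
        have "w (x, y) \<in> ?X \<times> ?Y" using permutes_in_image[OF perm] x y by blast
        then show "q x y \<in> ?Y" using wq[OF x y] by simp
      qed
      ultimately show "bij_betw (q x) ?Y ?Y"
        by (simp add: bij_betw_def endo_inj_surj)
    qed (simp add: q_def del: atLeastAtMost_iff)
    then show "w \<in> W" using perm p wq unfolding W_def by (auto simp: sym_group_def)
  qed
  then have "wreath ?X (Aut \<Delta>) ?Y (sym_group n) = perm_monoid (carrier (Aut (lex_empty \<Delta> ?Y)))"
    unfolding wreath_def W_def by simp
  then show ?thesis unfolding Aut_eq_perm_monoid[symmetric] .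
qed

lemma (in blow_up) Aut_iso_wreath:
  assumes fin: "finite (pverts \<Gamma>)" and "n > 0"
    and card: "\<And>x. x \<in> pverts \<Delta> \<Longrightarrow> card {v \<in> pverts \<Gamma>. \<pi> v = x} = n"
  shows "Aut \<Gamma> \<cong> wreath (pverts \<Delta>) (Aut \<Delta>) {1..n} (sym_group n)"
proof -
  obtain \<phi> where \<phi>: "bij_betw \<phi> (pverts \<Gamma>) (pverts \<Delta> \<times> {1..n})"
    "\<And>v. v \<in> pverts \<Gamma> \<Longrightarrow> fst (\<phi> v) = \<pi> v"
    using trivialization[OF fin card] by blast
  have "Aut \<Gamma> \<cong> Aut (lex_empty \<Delta> {1..n})"
  proof (rule Aut_iso_if_digraph_iso)
    show "bij_betw \<phi> (pverts \<Gamma>) (pverts (lex_empty \<Delta> {1..n}))"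
      using \<phi> by (simp add: lex_empty_def)
    fix u v assume "u \<in> pverts \<Gamma>" "v \<in> pverts \<Gamma>"
    then show "(\<phi> u, \<phi> v) \<in> parcs (lex_empty \<Delta> {1..n}) \<longleftrightarrow> (u, v) \<in> parcs \<Gamma>"
      using bij_betwE[OF \<phi>(1)] by (simp add: lex_empty_def \<phi>(2) arcs)
  qed
  then show ?thesis unfolding wreath_eq_Aut_lex_empty[OF \<open>n > 0\<close>] .
qed

section \<open>The two-sided stabilizer of a subset of a group\<close>

context group
begin

text \<open>
  The group of all \<open>g\<close> with \<open>g S = S = S g\<close>. Stating this with equivalences, for elements inside and
  outside \<open>S\<close> alike, makes closure under inverses immediate also when \<open>G\<close> is infinite.
\<close>

definition two_sided_stabilizer :: "'a set \<Rightarrow> 'a set" where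
  "two_sided_stabilizer S = {g \<in> carrier G. \<forall>x\<in>carrier G. (g \<otimes> x \<in> S \<longleftrightarrow> x \<in> S) \<and> (x \<otimes> g \<in> S \<longleftrightarrow> x \<in> S)}"

lemma two_sided_stabilizerD:
  assumes "g \<in> two_sided_stabilizer S" "x \<in> carrier G"
  shows "g \<otimes> x \<in> S \<longleftrightarrow> x \<in> S" "x \<otimes> g \<in> S \<longleftrightarrow> x \<in> S"
  using assms by (auto simp: two_sided_stabilizer_def)

lemma two_sided_stabilizer_is_subgroup: "subgroup (two_sided_stabilizer S) G"
proof
  show "two_sided_stabilizer S \<subseteq> carrier G" by (auto simp: two_sided_stabilizer_def)
  show "\<one> \<in> two_sided_stabilizer S" by (simp add: two_sided_stabilizer_def)
  fix g assume g: "g \<in> two_sided_stabilizer S"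
  then have gG: "g \<in> carrier G" by (simp add: two_sided_stabilizer_def)
  have cancel: "g \<otimes> (inv g \<otimes> x) = x" "(x \<otimes> inv g) \<otimes> g = x" if "x \<in> carrier G" for x
    using gG that by (simp add: m_assoc[symmetric], simp add: m_assoc)
  have "(inv g \<otimes> x \<in> S \<longleftrightarrow> x \<in> S) \<and> (x \<otimes> inv g \<in> S \<longleftrightarrow> x \<in> S)" if x: "x \<in> carrier G" for x
    using two_sided_stabilizerD(1)[OF g, of "inv g \<otimes> x"] two_sided_stabilizerD(2)[OF g, of "x \<otimes> inv g"] gG x
    by (simp add: cancel)
  then show "inv g \<in> two_sided_stabilizer S" using gG by (simp add: two_sided_stabilizer_def)
  fix h assume h: "h \<in> two_sided_stabilizer S"
  then have hG: "h \<in> carrier G" by (simp add: two_sided_stabilizer_def)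
  have "(g \<otimes> h \<otimes> x \<in> S \<longleftrightarrow> x \<in> S) \<and> (x \<otimes> (g \<otimes> h) \<in> S \<longleftrightarrow> x \<in> S)"
    if x: "x \<in> carrier G" for x
  proof -
    have "g \<otimes> h \<otimes> x = g \<otimes> (h \<otimes> x)" "x \<otimes> (g \<otimes> h) = x \<otimes> g \<otimes> h"
      using gG hG x by (simp_all add: m_assoc)
    then show ?thesis
      using two_sided_stabilizerD[OF g] two_sided_stabilizerD[OF h] gG hG x by simp
  qed
  then show "g \<otimes> h \<in> two_sided_stabilizer S" using gG hG by (simp add: two_sided_stabilizer_def)
qed

lemma two_sided_invariant_iff_subset_stabilizer:
  assumes S: "S \<subseteq> carrier G" and K: "subgroup K G"
  shows "S = K <#> S <#> K \<longleftrightarrow> K \<subseteq> two_sided_stabilizer S"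
proof
  have KG: "k \<in> carrier G" if "k \<in> K" for k using K that by (rule subgroup.mem_carrier)
  have one: "\<one> \<in> K" using K by (rule subgroup.one_closed)
  assume eq: "S = K <#> S <#> K"
  have prod: "a \<otimes> x \<otimes> b \<in> S" if "a \<in> K" "x \<in> S" "b \<in> K" for a x b
    using that by (subst eq) (auto simp: set_mult_def)
  have left: "k \<otimes> x \<in> S" and right: "x \<otimes> k \<in> S" if "k \<in> K" "x \<in> S" for k x
    using prod[OF that one] prod[OF one that(2,1)] that S KG by auto
  show "K \<subseteq> two_sided_stabilizer S"
  proof
    fix k assume k: "k \<in> K"
    then have k': "inv k \<in> K" using K by (simp add: subgroup.m_inv_closed)
    have "(k \<otimes> x \<in> S \<longleftrightarrow> x \<in> S) \<and> (x \<otimes> k \<in> S \<longleftrightarrow> x \<in> S)" if x: "x \<in> carrier G" for x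
    proof -
      have "inv k \<otimes> (k \<otimes> x) = x" "(x \<otimes> k) \<otimes> inv k = x"
        using KG[OF k] x by (simp add: m_assoc[symmetric], simp add: m_assoc)
      then show ?thesis
        using left[OF k, of x] left[OF k', of "k \<otimes> x"] right[OF k, of x] right[OF k', of "x \<otimes> k"]
        by metis
    qed
    then show "k \<in> two_sided_stabilizer S" using KG[OF k] by (simp add: two_sided_stabilizer_def)
  qed
next
  have KG: "k \<in> carrier G" if "k \<in> K" for k using K that by (rule subgroup.mem_carrier)
  assume sub: "K \<subseteq> two_sided_stabilizer S"
  have one: "\<one> \<in> K" using K by (rule subgroup.one_closed)
  show "S = K <#> S <#> K"
  proof
    show "S \<subseteq> K <#> S <#> K"
    proof
      fix x assume "x \<in> S"
      moreover from this have "x = \<one> \<otimes> x \<otimes> \<one>" using S by auto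
      ultimately show "x \<in> K <#> S <#> K" using one unfolding set_mult_def by blast
    qed
    show "K <#> S <#> K \<subseteq> S"
    proof
      fix y assume "y \<in> K <#> S <#> K"
      then obtain a x b where "a \<in> K" "x \<in> S" "b \<in> K" "y = a \<otimes> x \<otimes> b"
        unfolding set_mult_def by blast
      moreover have "a \<otimes> x \<in> S"
        using two_sided_stabilizerD(1)[of a S x] calculation sub S by blast
      ultimately show "y \<in> S" using two_sided_stabilizerD(2)[of b S "a \<otimes> x"] sub S by blast
    qed
  qed
qed

text \<open>
  The two-sided stabilizer is one of the subgroups \<open>L\<close> with \<open>S = L S L\<close>, and it contains all of them.
\<close>

lemma maximal_eq_two_sided_stabilizer:
  assumes S: "S \<subseteq> carrier G" and K: "subgroup K G" "S = K <#> S <#> K"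
    and H: "H \<subseteq> K"
    and maximal: "\<And>L. \<lbrakk>subgroup L G; H \<subseteq> L; S = L <#> S <#> L; K \<subseteq> L\<rbrakk> \<Longrightarrow> L = K"
  shows "K = two_sided_stabilizer S"
proof -
  have sub: "K \<subseteq> two_sided_stabilizer S"
    using two_sided_invariant_iff_subset_stabilizer[OF S K(1)] K(2) by blast
  have "S = two_sided_stabilizer S <#> S <#> two_sided_stabilizer S"
    using two_sided_invariant_iff_subset_stabilizer[OF S two_sided_stabilizer_is_subgroup] by blast
  then show ?thesis using maximal[OF two_sided_stabilizer_is_subgroup] sub H by blast
qed

section \<open>Cosets of two nested subgroups\<close>

lemma mem_l_coset_iff:
  assumes "subgroup H G" "x \<in> carrier G"
  shows "y \<in> x <# H \<longleftrightarrow> y \<in> carrier G \<and> inv x \<otimes> y \<in> H"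
proof
  assume "y \<in> x <# H"
  then obtain h where h: "h \<in> H" "y = x \<otimes> h" by (auto simp: l_coset_def)
  then have "h \<in> carrier G" using assms by (simp add: subgroup.mem_carrier)
  then show "y \<in> carrier G \<and> inv x \<otimes> y \<in> H" using h assms by (simp add: m_assoc[symmetric])
next
  assume y: "y \<in> carrier G \<and> inv x \<otimes> y \<in> H"
  then have "y = x \<otimes> (inv x \<otimes> y)" using assms by (simp add: m_assoc[symmetric])
  then show "y \<in> x <# H" using y by (auto simp: l_coset_def)
qed

lemma mult_inv_cancel_left: "\<lbrakk>x \<in> carrier G; s \<in> carrier G\<rbrakk> \<Longrightarrow> inv x \<otimes> (x \<otimes> s) = s"
  and mult_cancel_inv_left: "\<lbrakk>x \<in> carrier G; s \<in> carrier G\<rbrakk> \<Longrightarrow> x \<otimes> (inv x \<otimes> s) = s"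
  by (simp_all add: m_assoc[symmetric])

lemma inv_mult_mult_cancel:
  "\<lbrakk>x \<in> carrier G; y \<in> carrier G; z \<in> carrier G\<rbrakk> \<Longrightarrow> (inv x \<otimes> y) \<otimes> (inv y \<otimes> z) = inv x \<otimes> z"
  by (simp add: m_assoc mult_cancel_inv_left)

lemma l_coset_subset_iff:
  assumes H: "subgroup H G" and K: "subgroup K G" and "H \<subseteq> K"
    and x: "x \<in> carrier G" and y: "y \<in> carrier G"
  shows "x <# H \<subseteq> y <# K \<longleftrightarrow> inv y \<otimes> x \<in> K"
proof
  assume "x <# H \<subseteq> y <# K"
  moreover have "x \<in> x <# H" using H x by (simp add: mem_l_coset_iff subgroup.one_closed)
  ultimately show "inv y \<otimes> x \<in> K" using mem_l_coset_iff[OF K y] by blast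
next
  assume yx: "inv y \<otimes> x \<in> K"
  show "x <# H \<subseteq> y <# K"
  proof
    fix z assume "z \<in> x <# H"
    then have z: "z \<in> carrier G" "inv x \<otimes> z \<in> K"
      using mem_l_coset_iff[OF H x] \<open>H \<subseteq> K\<close> by auto
    then have "inv y \<otimes> z \<in> K"
      using subgroup.m_closed[OF K yx z(2)] x y by (simp add: inv_mult_mult_cancel)
    then show "z \<in> y <# K" using mem_l_coset_iff[OF K y] z by blast
  qed
qed

lemma inv_mult_sym:
  assumes K: "subgroup K G" and "x \<in> carrier G" "y \<in> carrier G" and xy: "inv x \<otimes> y \<in> K"
  shows "inv y \<otimes> x \<in> K"
  using subgroup.m_inv_closed[OF K xy] assms by (simp add: inv_mult_group)

lemma l_coset_eq_iff:
  assumes K: "subgroup K G" and "x \<in> carrier G" "y \<in> carrier G"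
  shows "x <# K = y <# K \<longleftrightarrow> inv x \<otimes> y \<in> K"
  using l_coset_subset_iff[OF K K subset_refl] inv_mult_sym[OF K] assms by blast

definition coset_block :: "'a set \<Rightarrow> 'a set \<Rightarrow> 'a \<Rightarrow> 'a set set" where
  "coset_block H K g = {C \<in> lcosets H. C \<subseteq> g <# K}"

lemma lcosets_eq: "lcosets H = (\<lambda>g. g <# H) ` carrier G"
  by (auto simp: LCOSETS_def)

lemma coset_partition_eq: "coset_partition (lcosets K) (lcosets H) = coset_block H K ` carrier G"
  by (auto simp: coset_partition_def coset_block_def lcosets_eq)

lemma coset_block_eq_iff:
  assumes H: "subgroup H G" and K: "subgroup K G" and HK: "H \<subseteq> K"
    and g: "g \<in> carrier G" and h: "h \<in> carrier G"
  shows "coset_block H K g = coset_block H K h \<longleftrightarrow> inv g \<otimes> h \<in> K"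
proof
  assume eq: "coset_block H K g = coset_block H K h"
  have "h <# H \<in> coset_block H K h"
    using h K by (auto simp: coset_block_def lcosets_eq l_coset_subset_iff[OF H K HK] subgroup.one_closed)
  then have "h <# H \<subseteq> g <# K" unfolding eq[symmetric] by (simp add: coset_block_def)
  then show "inv g \<otimes> h \<in> K" using l_coset_subset_iff[OF H K HK h g] by simp
next
  assume "inv g \<otimes> h \<in> K"
  then have "g <# K = h <# K" using l_coset_eq_iff[OF K g h] by simp
  then show "coset_block H K g = coset_block H K h" by (simp add: coset_block_def)
qed

section \<open>Cayley and double coset digraphs as blow-ups\<close>

text \<open>
  The digraph \<open>Cos(G, K, S)\<close>, with each left coset of \<open>K\<close> represented by the set of left cosets of \<open>H\<close>
  that it contains. For \<open>K\<close> the two-sided stabilizer of \<open>S\<close> it is the common twin-free quotient of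
  \<open>Cay(G, S)\<close> and \<open>Cos(G, H, S)\<close>.
\<close>

definition block_digraph :: "'a set \<Rightarrow> 'a set \<Rightarrow> 'a set \<Rightarrow> 'a set set pair_pre_digraph" where
  "block_digraph H K S =
    \<lparr> pverts = coset_partition (lcosets K) (lcosets H),
      parcs = {(coset_block H K g, coset_block H K (g \<otimes> s)) | g s. g \<in> carrier G \<and> s \<in> S} \<rparr>"

text \<open>
  Membership of \<open>a\<^sup>-\<^sup>1 b\<close> in \<open>S\<close> depends only on the cosets of \<open>a\<close> and \<open>b\<close>. This is why adjacency in the
  coset digraphs can be tested on arbitrary representatives.
\<close>

lemma two_sided_stabilizer_double_coset:
  assumes "inv a \<otimes> x \<in> two_sided_stabilizer S" "inv b \<otimes> y \<in> two_sided_stabilizer S"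
    and a: "a \<in> carrier G" and b: "b \<in> carrier G" and x: "x \<in> carrier G" and y: "y \<in> carrier G"
  shows "inv a \<otimes> b \<in> S \<longleftrightarrow> inv x \<otimes> y \<in> S"
proof -
  have "inv a \<otimes> b \<in> S \<longleftrightarrow> inv a \<otimes> y \<in> S"
    using two_sided_stabilizerD(2)[OF assms(2), of "inv a \<otimes> b"] a b y by (simp add: inv_mult_mult_cancel)
  also have "\<dots> \<longleftrightarrow> inv x \<otimes> y \<in> S"
    using two_sided_stabilizerD(1)[OF assms(1), of "inv x \<otimes> y"] a x y by (simp add: inv_mult_mult_cancel)
  finally show ?thesis .
qed

lemma block_digraph_arc_iff:
  assumes S: "S \<subseteq> carrier G" and H: "subgroup H G" and HK: "H \<subseteq> two_sided_stabilizer S"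
    and x: "x \<in> carrier G" and y: "y \<in> carrier G"
  shows "(coset_block H (two_sided_stabilizer S) x, coset_block H (two_sided_stabilizer S) y)
      \<in> parcs (block_digraph H (two_sided_stabilizer S) S) \<longleftrightarrow> inv x \<otimes> y \<in> S" (is "?arc \<longleftrightarrow> _")
proof
  assume ?arc
  then obtain g s where gs: "g \<in> carrier G" "s \<in> S"
    "coset_block H (two_sided_stabilizer S) x = coset_block H (two_sided_stabilizer S) g"
    "coset_block H (two_sided_stabilizer S) y = coset_block H (two_sided_stabilizer S) (g \<otimes> s)"
    by (auto simp: block_digraph_def)
  then have sG: "s \<in> carrier G" using S by blast
  have "inv x \<otimes> y \<in> S \<longleftrightarrow> inv g \<otimes> (g \<otimes> s) \<in> S"
    using gs sG x y
    by (intro two_sided_stabilizer_double_coset) (auto simp: coset_block_eq_iff[OF H two_sided_stabilizer_is_subgroup HK])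
  then show "inv x \<otimes> y \<in> S" using gs sG by (simp add: mult_inv_cancel_left)
next
  assume "inv x \<otimes> y \<in> S"
  moreover have "y = x \<otimes> (inv x \<otimes> y)" using x y by (simp add: mult_cancel_inv_left)
  ultimately have "\<exists>g s. x = g \<and> y = g \<otimes> s \<and> g \<in> carrier G \<and> s \<in> S" using x by blast
  then show ?arc by (auto simp: block_digraph_def)
qed

lemma Cay_arc_iff:
  assumes "S \<subseteq> carrier G" "x \<in> carrier G" "y \<in> carrier G"
  shows "(x, y) \<in> parcs (Cay G S) \<longleftrightarrow> inv x \<otimes> y \<in> S"
proof
  assume "(x, y) \<in> parcs (Cay G S)"
  then obtain s where "s \<in> S" "y = x \<otimes> s" by (auto simp: Cay_def)
  then show "inv x \<otimes> y \<in> S" using assms by (auto simp: mult_inv_cancel_left)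
next
  assume "inv x \<otimes> y \<in> S"
  moreover have "y = x \<otimes> (inv x \<otimes> y)" using assms by (simp add: mult_cancel_inv_left)
  ultimately show "(x, y) \<in> parcs (Cay G S)" using assms by (auto simp: Cay_def)
qed

lemma Cos_arc_iff:
  assumes S: "S \<subseteq> carrier G" and H: "subgroup H G" and HK: "H \<subseteq> two_sided_stabilizer S"
    and x: "x \<in> carrier G" and y: "y \<in> carrier G"
  shows "(x <# H, y <# H) \<in> parcs (Cos G H S) \<longleftrightarrow> inv x \<otimes> y \<in> S"
proof
  assume "(x <# H, y <# H) \<in> parcs (Cos G H S)"
  then obtain g s where gs: "g \<in> carrier G" "s \<in> S" "x <# H = g <# H" "y <# H = (g \<otimes> s) <# H"
    by (auto simp: Cos_def)
  then have sG: "s \<in> carrier G" using S by blast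
  have "inv x \<otimes> y \<in> S \<longleftrightarrow> inv g \<otimes> (g \<otimes> s) \<in> S"
    using gs sG x y HK by (intro two_sided_stabilizer_double_coset) (auto simp: l_coset_eq_iff[OF H])
  then show "inv x \<otimes> y \<in> S" using gs sG by (simp add: mult_inv_cancel_left)
next
  assume "inv x \<otimes> y \<in> S"
  moreover have "y = x \<otimes> (inv x \<otimes> y)" using x y by (simp add: mult_cancel_inv_left)
  ultimately have "\<exists>g s. x = g \<and> y = g \<otimes> s \<and> g \<in> carrier G \<and> s \<in> S" using x by blast
  then show "(x <# H, y <# H) \<in> parcs (Cos G H S)" by (auto simp: Cos_def)
qed

text \<open>
  The point is that the quotient is twin-free. Suppose that the cosets of \<open>g\<close> and \<open>h\<close> are twins.
  Comparing their arcs to the coset of \<open>h z\<close> shows that left multiplication by \<open>g\<^sup>-\<^sup>1 h\<close> preserves \<open>S\<close>,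
  and comparing their arcs from the coset of \<open>g z\<^sup>-\<^sup>1\<close> shows that right multiplication by it does; so
  \<open>g\<^sup>-\<^sup>1 h\<close> is in the stabilizer and the two cosets coincide.
\<close>

lemma blow_up_Cay:
  assumes S: "S \<subseteq> carrier G" and H: "subgroup H G" and HK: "H \<subseteq> two_sided_stabilizer S"
  shows "blow_up (Cay G S) (block_digraph H (two_sided_stabilizer S) S) (coset_block H (two_sided_stabilizer S))"
    (is "blow_up _ ?\<Delta> ?\<pi>")
proof
  show "?\<pi> ` pverts (Cay G S) = pverts ?\<Delta>"
    by (simp add: Cay_def block_digraph_def coset_partition_eq)
  show "(?\<pi> u, ?\<pi> v) \<in> parcs ?\<Delta> \<longleftrightarrow> (u, v) \<in> parcs (Cay G S)"
    if "u \<in> pverts (Cay G S)" "v \<in> pverts (Cay G S)" for u v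
  proof -
    have "u \<in> carrier G" "v \<in> carrier G" using that by (simp_all add: Cay_def)
    then show ?thesis by (simp add: block_digraph_arc_iff[OF S H HK] Cay_arc_iff[OF S])
  qed
  fix x y
  assume "x \<in> pverts ?\<Delta>" "y \<in> pverts ?\<Delta>"
  then obtain g h where g: "g \<in> carrier G" "x = ?\<pi> g" and h: "h \<in> carrier G" "y = ?\<pi> h"
    by (auto simp: block_digraph_def coset_partition_eq)
  have verts: "?\<pi> z \<in> pverts ?\<Delta>" if "z \<in> carrier G" for z
    using that by (simp add: block_digraph_def coset_partition_eq)
  assume out: "\<And>z. z \<in> pverts ?\<Delta> \<Longrightarrow> (x, z) \<in> parcs ?\<Delta> \<longleftrightarrow> (y, z) \<in> parcs ?\<Delta>"
    and in': "\<And>z. z \<in> pverts ?\<Delta> \<Longrightarrow> (z, x) \<in> parcs ?\<Delta> \<longleftrightarrow> (z, y) \<in> parcs ?\<Delta>"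
  have out': "inv g \<otimes> z \<in> S \<longleftrightarrow> inv h \<otimes> z \<in> S" if "z \<in> carrier G" for z
    using out[OF verts[OF that]] that g h by (simp add: block_digraph_arc_iff[OF S H HK])
  have in'': "inv z \<otimes> g \<in> S \<longleftrightarrow> inv z \<otimes> h \<in> S" if "z \<in> carrier G" for z
    using in'[OF verts[OF that]] that g h by (simp add: block_digraph_arc_iff[OF S H HK])
  have "(inv g \<otimes> h \<otimes> z \<in> S \<longleftrightarrow> z \<in> S) \<and> (z \<otimes> (inv g \<otimes> h) \<in> S \<longleftrightarrow> z \<in> S)"
    if z: "z \<in> carrier G" for z
  proof
    show "inv g \<otimes> h \<otimes> z \<in> S \<longleftrightarrow> z \<in> S"
      using out'[of "h \<otimes> z"] g(1) h(1) z by (simp add: mult_inv_cancel_left m_assoc)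
    have "inv (g \<otimes> inv z) \<otimes> g = z" "inv (g \<otimes> inv z) \<otimes> h = z \<otimes> (inv g \<otimes> h)"
      using g(1) h(1) z by (simp_all add: inv_mult_group m_assoc)
    then show "z \<otimes> (inv g \<otimes> h) \<in> S \<longleftrightarrow> z \<in> S"
      using in''[of "g \<otimes> inv z"] g(1) z by simp
  qed
  then have "inv g \<otimes> h \<in> two_sided_stabilizer S" using g(1) h(1) by (simp add: two_sided_stabilizer_def)
  then show "x = y" using g h by (simp add: coset_block_eq_iff[OF H two_sided_stabilizer_is_subgroup HK])
qed

lemma l_coset_set_mult_absorb:
  assumes H: "subgroup H G" and K: "subgroup K G" and HK: "H \<subseteq> K" and g: "g \<in> carrier G"
  shows "(g <# H) <#> K = g <# K"
proof
  show "(g <# H) <#> K \<subseteq> g <# K"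
  proof
    fix z assume "z \<in> (g <# H) <#> K"
    then obtain h k where hk: "h \<in> H" "k \<in> K" "z = g \<otimes> h \<otimes> k"
      by (auto simp: set_mult_def l_coset_def)
    then have "h \<otimes> k \<in> K" using HK K by (auto intro: subgroup.m_closed)
    moreover have "z = g \<otimes> (h \<otimes> k)"
      using hk g H K by (simp add: m_assoc subgroup.mem_carrier)
    ultimately show "z \<in> g <# K" by (auto simp: l_coset_def)
  qed
  show "g <# K \<subseteq> (g <# H) <#> K"
  proof
    fix z assume "z \<in> g <# K"
    then obtain k where "k \<in> K" "z = g \<otimes> \<one> \<otimes> k" using g by (auto simp: l_coset_def)
    then show "z \<in> (g <# H) <#> K"
      using subgroup.one_closed[OF H] by (auto simp: set_mult_def l_coset_def)
  qed
qed

text \<open>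
  The projection sends the coset \<open>C = g H\<close> to the part belonging to \<open>C K = g K\<close>, a description that
  avoids choosing the representative \<open>g\<close>.
\<close>

lemma block_blow_up_Cos:
  assumes S: "S \<subseteq> carrier G" and H: "subgroup H G" and HK: "H \<subseteq> two_sided_stabilizer S"
  shows "block_blow_up (Cos G H S) (block_digraph H (two_sided_stabilizer S) S)
    (\<lambda>C. {D \<in> lcosets H. D \<subseteq> C <#> two_sided_stabilizer S})"
    (is "block_blow_up _ ?\<Delta> ?\<rho>")
proof -
  let ?K = "two_sided_stabilizer S"
  interpret Cay: blow_up "Cay G S" ?\<Delta> "coset_block H ?K"
    using assms by (rule blow_up_Cay)
  have V: "pverts (Cos G H S) = (\<lambda>g. g <# H) ` carrier G" by (simp add: Cos_def lcosets_eq)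
  have \<rho>: "?\<rho> (g <# H) = coset_block H ?K g" if "g \<in> carrier G" for g
    using that by (simp add: l_coset_set_mult_absorb[OF H two_sided_stabilizer_is_subgroup HK] coset_block_def)
  show ?thesis
  proof
    show "?\<rho> ` pverts (Cos G H S) = pverts ?\<Delta>"
      by (simp add: V image_image \<rho> block_digraph_def coset_partition_eq)
    show "(?\<rho> u, ?\<rho> v) \<in> parcs ?\<Delta> \<longleftrightarrow> (u, v) \<in> parcs (Cos G H S)"
      if "u \<in> pverts (Cos G H S)" "v \<in> pverts (Cos G H S)" for u v
      using that
      by (auto simp: V \<rho> block_digraph_arc_iff[OF S H HK] Cos_arc_iff[OF S H HK])
    show "C \<in> D \<longleftrightarrow> C \<in> pverts (Cos G H S) \<and> ?\<rho> C = D" if "D \<in> pverts ?\<Delta>" for D C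
    proof -
      have "D \<in> coset_block H ?K ` carrier G"
        using that by (simp add: block_digraph_def coset_partition_eq)
      then obtain g where g: "g \<in> carrier G" and D: "D = coset_block H ?K g" by blast
      have "x <# H \<in> D \<longleftrightarrow> ?\<rho> (x <# H) = D" if x: "x \<in> carrier G" for x
      proof -
        have "x <# H \<in> D \<longleftrightarrow> inv g \<otimes> x \<in> ?K"
          using g x D by (auto simp: coset_block_def lcosets_eq
            l_coset_subset_iff[OF H two_sided_stabilizer_is_subgroup HK])
        also have "\<dots> \<longleftrightarrow> ?\<rho> (x <# H) = D"
          using coset_block_eq_iff[OF H two_sided_stabilizer_is_subgroup HK g x] by (auto simp: \<rho>[OF x] D)
        finally show ?thesis .
      qed
      moreover have "D \<subseteq> pverts (Cos G H S)" by (auto simp: D coset_block_def Cos_def)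
      ultimately show ?thesis unfolding V by blast
    qed
  qed (rule Cay.twin_free)
qed

text \<open>
  Left translation by \<open>y x\<^sup>-\<^sup>1\<close> takes \<open>x H\<close> to \<open>y H\<close>, and left translations do not change the
  elements \<open>g\<^sup>-\<^sup>1 h\<close> on which adjacency depends.
\<close>

lemma Aut_Cos_transitive:
  assumes S: "S \<subseteq> carrier G" and H: "subgroup H G" and HK: "H \<subseteq> two_sided_stabilizer S"
  shows "transitive_on (pverts (Cos G H S)) (Aut (Cos G H S))"
  unfolding transitive_on_def
proof (intro ballI)
  let ?V = "pverts (Cos G H S)"
  have V: "?V = (\<lambda>g. g <# H) ` carrier G" by (simp add: Cos_def lcosets_eq)
  fix C D assume "C \<in> ?V" "D \<in> ?V"
  then obtain x y where x: "x \<in> carrier G" "C = x <# H" and y: "y \<in> carrier G" "D = y <# H"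
    by (auto simp: V)
  define t where "t = y \<otimes> inv x"
  have t: "t \<in> carrier G" using x y by (simp add: t_def)
  define a where "a E = (if E \<in> ?V then t <# E else E)" for E
  have a: "a (g <# H) = (t \<otimes> g) <# H" if "g \<in> carrier G" for g
    using that t subgroup.subset[OF H] by (simp add: a_def V lcos_m_assoc)
  have tinv: "inv (t \<otimes> g) \<otimes> (t \<otimes> h) = inv g \<otimes> h" if "g \<in> carrier G" "h \<in> carrier G" for g h
    using that t by (simp add: inv_mult_group m_assoc mult_inv_cancel_left)
  have "bij_betw a ?V ?V"
  proof (rule bij_betw_imageI)
    show "inj_on a ?V"
    proof (rule inj_onI)
      fix E F assume "E \<in> ?V" "F \<in> ?V" and eq: "a E = a F"
      then obtain g h where gh: "g \<in> carrier G" "h \<in> carrier G" "E = g <# H" "F = h <# H"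
        by (auto simp: V)
      then have "(t \<otimes> g) <# H = (t \<otimes> h) <# H" using eq by (simp add: a)
      then have "inv g \<otimes> h \<in> H" using gh t by (simp add: l_coset_eq_iff[OF H] tinv)
      then show "E = F" using gh by (simp add: l_coset_eq_iff[OF H])
    qed
    show "a ` ?V = ?V"
    proof
      show "a ` ?V \<subseteq> ?V" using t by (auto simp: V a)
      show "?V \<subseteq> a ` ?V"
      proof
        fix E assume "E \<in> ?V"
        then obtain g where g: "g \<in> carrier G" "E = g <# H" by (auto simp: V)
        then have "E = a ((inv t \<otimes> g) <# H)" using t by (simp add: a mult_cancel_inv_left)
        then show "E \<in> a ` ?V" using g t by (auto simp: V)
      qed
    qed
  qed
  then have "a permutes ?V" by (rule bij_imp_permutes) (simp add: a_def)
  then have "a \<in> carrier (Aut (Cos G H S))"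
  proof (rule Aut_memI)
    fix u v assume "u \<in> ?V" "v \<in> ?V"
    then show "(a u, a v) \<in> parcs (Cos G H S) \<longleftrightarrow> (u, v) \<in> parcs (Cos G H S)"
      using t by (auto simp: V a Cos_arc_iff[OF S H HK] tinv)
  qed
  moreover have "a C = D" using x y by (simp add: a t_def m_assoc)
  ultimately show "\<exists>a\<in>carrier (Aut (Cos G H S)). a C = D" by blast
qed

end

section \<open>The automorphism group of the Cayley digraph\<close>

theorem corollary4p11:
  fixes G :: "('a, 'b) monoid_scheme" (structure)
    and H K S :: "'a set"
    and \<B> \<C> :: "'a set set"
    and k :: nat
  assumes "group G" and "finite (carrier G)"
    and "subgroup H G"
    and "S \<subseteq> carrier G"
    and "S = H <#> S <#> H"
    and "S \<inter> H = {}"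
    and "subgroup K G" and "H \<subseteq> K" and "S = K <#> S <#> K"
    and K_maximal: "\<And>L. \<lbrakk>subgroup L G; H \<subseteq> L; S = L <#> S <#> L; K \<subseteq> L\<rbrakk> \<Longrightarrow> L = K"
    and "\<B> = lcosets K" and "\<C> = lcosets H" and "k = card K"
  shows "block_system \<C> (Aut (Cos G H S)) (coset_partition \<B> \<C>) \<and>
    Aut (Cay G S) \<cong>
      wreath (coset_partition \<B> \<C>) (block_quotient (Aut (Cos G H S)) (coset_partition \<B> \<C>))
        {1..k} (sym_group k)"
proof -
  interpret group G by fact
  have K: "K = two_sided_stabilizer S"
    using \<open>S \<subseteq> carrier G\<close> \<open>subgroup K G\<close> \<open>S = K <#> S <#> K\<close> \<open>H \<subseteq> K\<close> K_maximal
    by (rule maximal_eq_two_sided_stabilizer)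
  have HK: "H \<subseteq> two_sided_stabilizer S" using \<open>H \<subseteq> K\<close> K by simp
  note SH = \<open>S \<subseteq> carrier G\<close> \<open>subgroup H G\<close> HK
  let ?\<Delta> = "block_digraph H K S" and ?\<rho> = "\<lambda>C. {D \<in> lcosets H. D \<subseteq> C <#> K}"
  interpret Cay: blow_up "Cay G S" ?\<Delta> "coset_block H K"
    unfolding K using SH by (rule blow_up_Cay)
  interpret Cos: block_blow_up "Cos G H S" ?\<Delta> ?\<rho>
    unfolding K using SH by (rule block_blow_up_Cos)
  have \<Delta>: "pverts ?\<Delta> = coset_partition \<B> \<C>"
    using \<open>\<B> = _\<close> \<open>\<C> = _\<close> by (simp add: block_digraph_def)
  have \<C>: "pverts (Cos G H S) = \<C>" using \<open>\<C> = _\<close> by (simp add: Cos_def)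
  note trans = Aut_Cos_transitive[OF SH]
  have "block_quotient (Aut (Cos G H S)) (pverts ?\<Delta>) = Aut ?\<Delta>"
  proof -
    have fin: "finite (pverts (Cos G H S))"
      using \<open>finite (carrier G)\<close> by (simp add: Cos_def lcosets_eq)
    have "\<one> <# H \<in> pverts (Cos G H S)"
      by (simp add: Cos_def lcosets_eq)
    \<comment> \<open>By transitivity all fibres have the size of the fibre of the coset \<open>H\<close> itself.\<close>
    then obtain \<phi> where "bij_betw \<phi> (pverts (Cos G H S))
        (pverts ?\<Delta> \<times> {1..card {C \<in> pverts (Cos G H S). ?\<rho> C = ?\<rho> (\<one> <# H)}})"
      "\<And>C. C \<in> pverts (Cos G H S) \<Longrightarrow> fst (\<phi> C) = ?\<rho> C"
      using Cos.trivialization[OF fin Cos.card_fibre_const[OF fin trans]] by blast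
    then show ?thesis by (rule Cos.block_quotient_blow_up)
  qed
  moreover have "Aut (Cay G S) \<cong> wreath (pverts ?\<Delta>) (Aut ?\<Delta>) {1..k} (sym_group k)"
  proof (rule Cay.Aut_iso_wreath)
    show "finite (pverts (Cay G S))" using \<open>finite (carrier G)\<close> by (simp add: Cay_def)
    show "k > 0"
      using \<open>finite (carrier G)\<close> \<open>k = card K\<close> \<open>subgroup K G\<close>
      by (metis card_gt_0_iff empty_iff finite_subset subgroup.one_closed subgroup.subset)
    fix D assume "D \<in> pverts ?\<Delta>"
    then obtain g where g: "g \<in> carrier G" "D = coset_block H K g"
      by (auto simp: block_digraph_def coset_partition_eq)
    have "{v \<in> pverts (Cay G S). coset_block H K v = D} = g <# K"
      using coset_block_eq_iff[OF \<open>subgroup H G\<close> \<open>subgroup K G\<close> \<open>H \<subseteq> K\<close> g(1)] g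
        mem_l_coset_iff[OF \<open>subgroup K G\<close> g(1)]
      by (auto simp: Cay_def)
    moreover have "card K = card (g <# K)"
      using \<open>finite (carrier G)\<close> subgroup.subset[OF \<open>subgroup K G\<close>] g(1)
      by (intro l_card_cosets_equal) (auto simp: lcosets_eq)
    ultimately show "card {v \<in> pverts (Cay G S). coset_block H K v = D} = k"
      using \<open>k = card K\<close> by simp
  qed
  ultimately show ?thesis
    using Cos.block_system_blow_up[OF trans] by (simp add: \<Delta> \<C>)
qed

end
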